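(* Let $N,M\ge 1$, $\mathcal{S}=\{1,\dots,N\}$, $\mathcal{A}_1=\mathcal{A}_2=\{1,\dots,M\}$, let $p(s'|s,a^1,a^2)$ be state transition probabilities, $\gamma\in[0,1)$ a discount factor, and let $\pi$ be a bi-policy. For a reward vector $r\in\mathbb{R}^{NM^2}$ of player 1 consider the two-player zero-sum discounted stochastic game with reward $r$ for player 1 and $-r$ for player 2. Let $P$, $G_\pi$, $B_\pi$, $B_{\pi^1|a^2=j}$, $B_{\pi^2|a^1=i}$ be the matrices defined in the context, and let $$D_\pi = I+\gamma P(I-\gamma G_\pi)^{-1}B_\pi .$$ Then: (1) For every $r\in\mathbb{R}^{NM^2}$, $\pi$ is a minimax bi-policy of the game with reward $r$ if and only if (componentwise) $$(B_{\pi^1|a^2=j}-B_\pi)D_\pi r\ \ge\ 0\quad\text{for all } j\in\mathcal{A}_2,\qquad (B_{\pi^2|a^1=i}-B_\pi)D_\pi r\ \le\ 0\quad\text{for all } i\in\mathcal{A}_1 .$$ (2) Let $\mu_r\in\mathbb{R}^{NM^2}$, let $\Sigma_r$ be a symmetric positive definite $NM^2\times NM^2$ matrix, and let $f$ be the density of the Gaussian distribution $\mathcal{N}(\mu_r,\Sigma_r)$. Let $p(\pi|r)=1$ if $\pi$ is a minimax bi-policy of the game with reward $r$, and $p(\pi|r)=0$ otherwise. Then the problem of maximizing $f(r)$ over $r\in\mathbb{R}^{NM^2}$ subject to $p(\pi|r)=1$ is equivalent (same feasible set and same set of optimal solutions) to the convex quadratic program $$\begin{aligned}\text{minimize}\quad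 & \tfrac12 (r-\mu_r)^T\Sigma_r^{-1}(r-\mu_r)\\ \text{subject to}\quad & (B_{\pi^2|a^1=i}-B_\pi)D_\pi r\le 0\quad\text{for all } i\in\mathcal{A}_1,\\ & (B_{\pi^1|a^2=j}-B_\pi)D_\pi r\ge 0\quad\text{for all } j\in\mathcal{A}_2.\end{aligned}$$
   Context: Game. For all $s,a^1,a^2$, $p(\cdot|s,a^1,a^2)$ is a probability distribution on $\mathcal{S}$. In each stage, in state $s$, both players simultaneously choose actions $a^1\in\mathcal{A}_1$, $a^2\in\mathcal{A}_2$; player 1 receives $r(s,a^1,a^2)$, player 2 receives $-r(s,a^1,a^2)$, and the next state is drawn from $p(\cdot|s,a^1,a^2)$. Rewards are accumulated over an infinite horizon with discount factor $\gamma$. Bi-policies. A bi-policy is $\pi=(\pi^1,\pi^2)$, where for each $k\in\{1,2\}$ and each $s$, $\pi^k(\cdot|s)$ is a probability mass function on $\mathcal{A}_k$; $\pi^k(s)\in\mathbb{R}^M$ denotes the corresponding column vector. Vector and matrix conventions. Vectors in $\mathbb{R}^{NM^2}$ are indexed by triples $(s,a^1,a^2)$, ordered in blocks by action pair $(1,1),(1,2),\dots,(M,M)$ and within each block by state $1,\dots,N$. $P$ is the $NM^2\times N$ matrix whose entry in row $(s,a^1,a^2)$ and column $s'$ is $p(s'|s,a^1,a^2)$. $B_\pi$ is the $N\times NM^2$ matrix whose entry in row $k$ and column $(s,i,j)$ is $\pi^1(i|k)\pi^2(j|k)$ if $s=k$ and $0$ otherwise. $G_\pi$ is the $N\times N$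 matrix with entry $\sum_{a^1,a^2}\pi^1(a^1|s)\pi^2(a^2|s)p(s'|s,a^1,a^2)$ in row $s$, column $s'$. $B_{\pi^1|a^2=j}$ is the matrix $B$ of the bi-policy in which player 1 uses $\pi^1$ and player 2 selects action $j$ with probability one in every state; $B_{\pi^2|a^1=i}$ is the matrix $B$ of the bi-policy in which player 2 uses $\pi^2$ and player 1 selects action $i$ with probability one in every state. $I$ denotes an identity matrix of the appropriate size. Value and $Q$-function. Given $r$ and $\pi$, let $\tilde r_\pi(s)=\sum_{a^1,a^2}\pi^1(a^1|s)\pi^2(a^2|s)r(s,a^1,a^2)$, and let $V_\pi(s)=\sum_{t=0}^\infty\gamma^t E(\tilde r_\pi(s_t)\,|\,s_0=s)$, where $(s_t)$ is the Markov chain with transition matrix $G_\pi$. Let $Q_\pi(s,a^1,a^2)=r(s,a^1,a^2)+\gamma\sum_{s'}p(s'|s,a^1,a^2)V_\pi(s')$, and let $Q_\pi(s)$ be the $M\times M$ matrix with $(i,j)$ entry $Q_\pi(s,i,j)$. Minimax bi-policy. For an $M\times M$ real matrix $A$ (payoffs to player 1, who chooses the row), $\mathrm{value}(A)=\max_x\min_y x^TAy$, with $x,y$ ranging over probability vectors in $\mathbb{R}^M$. A pair $(x,y)$ of probability vectors is a minimax bi-strategy (equilibrium) for $A$ if, given $y$, the best expected reward possible for player 1 is $\mathrm{value}(A)$, and, given $x$, the best expected reward possible for player 2 (whose payoff matrix is $-A$) is $-\mathrm{value}(A)$. A bi-policy $\pi$ is a minimax bi-policy of the game with reward $r$ if for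 every $s\in\mathcal{S}$, $(\pi^1(s),\pi^2(s))$ is a minimax bi-strategy for the matrix $Q_\pi(s)$ and $V_\pi(s)=\mathrm{value}(Q_\pi(s))$. *)

theory Defs
  imports "HOL-Analysis.Analysis" "HOL-Probability.Probability"
begin

text \<open>States are the elements of the finite type \<open>'s\<close> and the actions of either player those of the
  finite type \<open>'a\<close>, so \<open>N = CARD('s)\<close> and \<open>M = CARD('a)\<close>.  Vectors in $R^{NM^2}$ are indexed by
  triples (state, action of player 1, action of player 2).\<close>

type_synonym ('s, 'a) transition = "'s \<Rightarrow> 'a \<Rightarrow> 'a \<Rightarrow> 's pmf"
type_synonym ('s, 'a) bipolicy = "('s \<Rightarrow> 'a pmf) \<times> ('s \<Rightarrow> 'a pmf)"
type_synonym ('s, 'a) reward = "real ^ ('s \<times> 'a \<times> 'a)"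

definition policy_vec :: "('s \<Rightarrow> 'a::finite pmf) \<Rightarrow> 's \<Rightarrow> real ^ 'a" where
  "policy_vec q s = (\<chi> a. pmf (q s) a)"

definition P_mat :: "('s::finite, 'a::finite) transition \<Rightarrow> real ^ 's ^ ('s \<times> 'a \<times> 'a)" where
  "P_mat p = (\<chi> k. \<chi> s'. (case k of (s, a1, a2) \<Rightarrow> pmf (p s a1 a2) s'))"

definition B_mat :: "('s::finite, 'a::finite) bipolicy \<Rightarrow> real ^ ('s \<times> 'a \<times> 'a) ^ 's" where
  "B_mat \<pi> = (\<chi> k. \<chi> c. (case c of (s, i, j) \<Rightarrow>
     if s = k then pmf (fst \<pi> k) i * pmf (snd \<pi> k) j else 0))"

definition G_mat :: "('s::finite, 'a::finite) transition \<Rightarrow> ('s, 'a) bipolicy \<Rightarrow> real ^ 's ^ 's" where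
  "G_mat p \<pi> = (\<chi> s. \<chi> s'. \<Sum>a1\<in>UNIV. \<Sum>a2\<in>UNIV.
     pmf (fst \<pi> s) a1 * pmf (snd \<pi> s) a2 * pmf (p s a1 a2) s')"

definition B_fix2 :: "('s::finite, 'a::finite) bipolicy \<Rightarrow> 'a \<Rightarrow> real ^ ('s \<times> 'a \<times> 'a) ^ 's" where
  "B_fix2 \<pi> j = B_mat (fst \<pi>, \<lambda>s. return_pmf j)"

definition B_fix1 :: "('s::finite, 'a::finite) bipolicy \<Rightarrow> 'a \<Rightarrow> real ^ ('s \<times> 'a \<times> 'a) ^ 's" where
  "B_fix1 \<pi> i = B_mat (\<lambda>s. return_pmf i, snd \<pi>)"

definition D_mat :: "('s::finite, 'a::finite) transition \<Rightarrow> real \<Rightarrow> ('s, 'a) bipolicy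
    \<Rightarrow> real ^ ('s \<times> 'a \<times> 'a) ^ ('s \<times> 'a \<times> 'a)" where
  "D_mat p \<gamma> \<pi> = mat 1 +
     \<gamma> *\<^sub>R (P_mat p ** matrix_inv (mat 1 - \<gamma> *\<^sub>R G_mat p \<pi>) ** B_mat \<pi>)"

definition step_law :: "('s, 'a) transition \<Rightarrow> ('s, 'a) bipolicy \<Rightarrow> 's \<Rightarrow> 's pmf" where
  "step_law p \<pi> s = bind_pmf (fst \<pi> s) (\<lambda>a1. bind_pmf (snd \<pi> s) (\<lambda>a2. p s a1 a2))"

text \<open>The chain with kernel \<^const>\<open>step_law\<close> is the Markov chain with transition matrix \<^const>\<open>G_mat\<close>.\<close>

lemma pmf_step_law: "pmf (step_law p \<pi> s) s' = G_mat p \<pi> $ s $ s'"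
  by (simp add: step_law_def G_mat_def pmf_bind integral_measure_pmf_real[where A = UNIV]
      sum_distrib_right sum_distrib_left mult_ac)

text \<open>\<open>state_law p \<pi> s t\<close> is the law of $s_t$ given $s_0 = s$.\<close>

primrec state_law :: "('s, 'a) transition \<Rightarrow> ('s, 'a) bipolicy \<Rightarrow> 's \<Rightarrow> nat \<Rightarrow> 's pmf" where
  "state_law p \<pi> s 0 = return_pmf s"
| "state_law p \<pi> s (Suc t) = bind_pmf (state_law p \<pi> s t) (step_law p \<pi>)"

definition mean_reward :: "('s::finite, 'a::finite) reward \<Rightarrow> ('s, 'a) bipolicy \<Rightarrow> 's \<Rightarrow> real" where
  "mean_reward r \<pi> s = (\<Sum>a1\<in>UNIV. \<Sum>a2\<in>UNIV.
     pmf (fst \<pi> s) a1 * pmf (snd \<pi> s) a2 * r $ (s, a1, a2))"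

definition V_fun :: "('s::finite, 'a::finite) transition \<Rightarrow> real \<Rightarrow> ('s, 'a) reward
    \<Rightarrow> ('s, 'a) bipolicy \<Rightarrow> 's \<Rightarrow> real" where
  "V_fun p \<gamma> r \<pi> s =
     (\<Sum>t. \<gamma> ^ t * measure_pmf.expectation (state_law p \<pi> s t) (mean_reward r \<pi>))"

definition Q_fun :: "('s::finite, 'a::finite) transition \<Rightarrow> real \<Rightarrow> ('s, 'a) reward
    \<Rightarrow> ('s, 'a) bipolicy \<Rightarrow> 's \<Rightarrow> 'a \<Rightarrow> 'a \<Rightarrow> real" where
  "Q_fun p \<gamma> r \<pi> s a1 a2 =
     r $ (s, a1, a2) + \<gamma> * (\<Sum>s'\<in>UNIV. pmf (p s a1 a2) s' * V_fun p \<gamma> r \<pi> s')"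

definition Q_mat :: "('s::finite, 'a::finite) transition \<Rightarrow> real \<Rightarrow> ('s, 'a) reward
    \<Rightarrow> ('s, 'a) bipolicy \<Rightarrow> 's \<Rightarrow> real ^ 'a ^ 'a" where
  "Q_mat p \<gamma> r \<pi> s = (\<chi> i. \<chi> j. Q_fun p \<gamma> r \<pi> s i j)"

definition prob_vecs :: "(real ^ 'a::finite) set" where
  "prob_vecs = {x. (\<forall>i. 0 \<le> x $ i) \<and> (\<Sum>i\<in>UNIV. x $ i) = 1}"

text \<open>Both extrema are attained, see \<open>matrix_value_attained\<close> below.\<close>

definition matrix_value :: "real ^ 'a ^ 'a::finite \<Rightarrow> real" where
  "matrix_value A = (SUP x\<in>prob_vecs. INF y\<in>prob_vecs. x \<bullet> (A *v y))"

definition minimax_bistrategy ::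
    "real ^ 'a ^ 'a::finite \<Rightarrow> real ^ 'a \<Rightarrow> real ^ 'a \<Rightarrow> bool" where
  "minimax_bistrategy A x y \<longleftrightarrow> x \<in> prob_vecs \<and> y \<in> prob_vecs \<and>
     (SUP x'\<in>prob_vecs. x' \<bullet> (A *v y)) = matrix_value A \<and>
     (SUP y'\<in>prob_vecs. x \<bullet> ((- A) *v y')) = - matrix_value A"

definition minimax_bipolicy :: "('s::finite, 'a::finite) transition \<Rightarrow> real \<Rightarrow> ('s, 'a) reward
    \<Rightarrow> ('s, 'a) bipolicy \<Rightarrow> bool" where
  "minimax_bipolicy p \<gamma> r \<pi> \<longleftrightarrow> (\<forall>s.
     minimax_bistrategy (Q_mat p \<gamma> r \<pi> s) (policy_vec (fst \<pi>) s) (policy_vec (snd \<pi>) s) \<and>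
     V_fun p \<gamma> r \<pi> s = matrix_value (Q_mat p \<gamma> r \<pi> s))"

definition likelihood :: "('s::finite, 'a::finite) transition \<Rightarrow> real \<Rightarrow> ('s, 'a) bipolicy
    \<Rightarrow> ('s, 'a) reward \<Rightarrow> real" where
  "likelihood p \<gamma> \<pi> r = (if minimax_bipolicy p \<gamma> r \<pi> then 1 else 0)"

definition sym_pos_def :: "real ^ 'n ^ 'n::finite \<Rightarrow> bool" where
  "sym_pos_def \<Sigma> \<longleftrightarrow> transpose \<Sigma> = \<Sigma> \<and> (\<forall>x. x \<noteq> 0 \<longrightarrow> 0 < x \<bullet> (\<Sigma> *v x))"

definition gaussian_density ::
    "real ^ 'n::finite \<Rightarrow> real ^ 'n ^ 'n \<Rightarrow> real ^ 'n \<Rightarrow> real" where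
  "gaussian_density \<mu> \<Sigma> r =
     exp (- (1 / 2) * ((r - \<mu>) \<bullet> (matrix_inv \<Sigma> *v (r - \<mu>)))) / sqrt ((2 * pi) ^ CARD('n) * det \<Sigma>)"

definition qp_objective ::
    "real ^ 'n::finite \<Rightarrow> real ^ 'n ^ 'n \<Rightarrow> real ^ 'n \<Rightarrow> real" where
  "qp_objective \<mu> \<Sigma> r = (1 / 2) * ((r - \<mu>) \<bullet> (matrix_inv \<Sigma> *v (r - \<mu>)))"

text \<open>The order on \<^typ>\<open>real ^ 'n\<close> is the componentwise one.\<close>

definition qp_feasible :: "('s::finite, 'a::finite) transition \<Rightarrow> real \<Rightarrow> ('s, 'a) bipolicy
    \<Rightarrow> ('s, 'a) reward \<Rightarrow> bool" where
  "qp_feasible p \<gamma> \<pi> r \<longleftrightarrow>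
     (\<forall>i. ((B_fix1 \<pi> i - B_mat \<pi>) ** D_mat p \<gamma> \<pi>) *v r \<le> 0) \<and>
     (\<forall>j. ((B_fix2 \<pi> j - B_mat \<pi>) ** D_mat p \<gamma> \<pi>) *v r \<ge> 0)"

lemma compact_prob_vecs: "compact (prob_vecs :: (real ^ 'a::finite) set)"
proof -
  have "closed (prob_vecs :: (real ^ 'a) set)"
    unfolding prob_vecs_def
    by (intro closed_Collect_conj closed_Collect_all closed_Collect_le closed_Collect_eq
        continuous_intros)
  moreover have "prob_vecs \<subseteq> cball (0 :: real ^ 'a) 1"
  proof
    fix x :: "real ^ 'a"
    assume x: "x \<in> prob_vecs"
    have "norm x \<le> (\<Sum>i\<in>UNIV. \<bar>x $ i\<bar>)"
      by (rule norm_le_l1_cart)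
    also have "\<dots> = 1"
      using x by (simp add: prob_vecs_def)
    finally show "x \<in> cball 0 1" by simp
  qed
  ultimately show ?thesis
    using bounded_subset compact_eq_bounded_closed by blast
qed

lemma prob_vecs_nonempty: "(prob_vecs :: (real ^ 'a::finite) set) \<noteq> {}"
proof -
  have "axis (undefined :: 'a) (1 :: real) \<in> prob_vecs"
    by (simp add: prob_vecs_def axis_def)
  then show ?thesis by blast
qed

lemma matrix_value_attained:
  fixes A :: "real ^ 'a ^ 'a::finite"
  shows "\<exists>x\<in>prob_vecs. matrix_value A = (INF y\<in>prob_vecs. x \<bullet> (A *v y))"
    and "\<exists>y\<in>prob_vecs. (INF y'\<in>prob_vecs. x \<bullet> (A *v y')) = x \<bullet> (A *v y)"
proof -
  let ?D = "prob_vecs :: (real ^ 'a) set"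
  have cont: "continuous_on T (\<lambda>y. z \<bullet> (A *v y))" for z T
    by (intro continuous_intros matrix_vector_mult_linear_continuous_on)
  have inner: "\<exists>y\<in>?D. (\<forall>y'\<in>?D. z \<bullet> (A *v y) \<le> z \<bullet> (A *v y')) \<and>
      (INF y'\<in>?D. z \<bullet> (A *v y')) = z \<bullet> (A *v y)" for z
  proof -
    obtain y where y: "y \<in> ?D" "\<And>y'. y' \<in> ?D \<Longrightarrow> z \<bullet> (A *v y) \<le> z \<bullet> (A *v y')"
      using continuous_attains_inf[OF compact_prob_vecs prob_vecs_nonempty cont[of _ z]] by blast
    have "(INF y'\<in>?D. z \<bullet> (A *v y')) = z \<bullet> (A *v y)"
      by (rule cInf_eq_minimum) (use y in auto)
    with y show ?thesis by blast
  qed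
  then show "\<exists>y\<in>prob_vecs. (INF y'\<in>prob_vecs. x \<bullet> (A *v y')) = x \<bullet> (A *v y)"
    by blast
  define g where "g x = (INF y'\<in>?D. x \<bullet> (A *v y'))" for x
  have g_le: "g z \<le> z \<bullet> (A *v y)" if "y \<in> ?D" for z y
    using inner[of z] that unfolding g_def by metis
  have g_ge: "v \<le> g z" if "\<And>y. y \<in> ?D \<Longrightarrow> v \<le> z \<bullet> (A *v y)" for v z
    using inner[of z] that unfolding g_def by metis
  obtain x0 where x0: "x0 \<in> ?D" using prob_vecs_nonempty by blast
  have contl: "continuous_on T (\<lambda>z. z \<bullet> (A *v y))" for y T
    by (intro continuous_intros)
  obtain C where C: "\<And>z. z \<in> ?D \<Longrightarrow> z \<bullet> (A *v x0) \<le> C"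
    using continuous_attains_sup[OF compact_prob_vecs prob_vecs_nonempty contl[of _ x0]] by blast
  let ?S = "(?D \<times> {g x0..C}) \<inter> {q. \<forall>y\<in>?D. snd q \<le> fst q \<bullet> (A *v y)}"
  have "closed (\<Inter>y\<in>?D. {q :: (real ^ 'a) \<times> real. snd q \<le> fst q \<bullet> (A *v y)})"
    by (intro closed_INT ballI closed_Collect_le continuous_intros)
  also have "(\<Inter>y\<in>?D. {q. snd q \<le> fst q \<bullet> (A *v y)}) =
      {q. \<forall>y\<in>?D. snd q \<le> fst q \<bullet> (A *v y)}"
    by auto
  finally have "compact ?S"
    by (intro compact_Int_closed compact_Times compact_prob_vecs compact_Icc)
  moreover have in_S: "(z, g z) \<in> ?S" if "z \<in> ?D" "g x0 \<le> g z" for z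
    using that g_le C[OF that(1)] g_le[OF x0, of z] by auto
  moreover from this[OF x0] have "?S \<noteq> {}" by blast
  ultimately have "\<exists>q\<in>?S. \<forall>q'\<in>?S. snd q' \<le> snd q"
    by (intro continuous_attains_sup continuous_intros)
  then obtain q where q: "q \<in> ?S" "\<And>q'. q' \<in> ?S \<Longrightarrow> snd q' \<le> snd q"
    by blast
  let ?x = "fst q"
  have xD: "?x \<in> ?D" and le: "snd q \<le> g ?x" and "g x0 \<le> snd q"
    using q(1) by (auto simp: mem_Times_iff intro: g_ge)
  have "g z \<le> g ?x" if "z \<in> ?D" for z
    using q(2)[OF in_S[OF that]] le \<open>g x0 \<le> snd q\<close> by (cases "g x0 \<le> g z") auto
  then have "(SUP z\<in>?D. g z) = g ?x"
    by (intro cSup_eq_maximum) (use xD in auto)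
  then show "\<exists>x\<in>prob_vecs. matrix_value A = (INF y\<in>prob_vecs. x \<bullet> (A *v y))"
    using xD unfolding matrix_value_def g_def by blast
qed

end

theory Submission
  imports Defs
begin

text \<open>The vector \<open>D\<^sub>\<pi> r\<close> is the \<open>Q\<close>-function of \<open>\<pi>\<close>: by the Bellman equation \<open>V = (I - \<gamma> G)\<inverse> B r\<close>, hence
  \<open>D r = r + \<gamma> P V = Q\<close>, and moreover \<open>B D r = V\<close>.  The linear inequalities therefore say that at
  every state no pure deviation of either player improves on the expected payoff, which is
  the saddle point condition characterising equilibria of the matrix game \<open>Q\<^sub>\<pi>(s)\<close>, and makes \<open>V(s)\<close>
  the value of that game.  The Gaussian density is a decreasing function of the quadratic
  objective.\<close>

subsection \<open>Saddle points of matrix games\<close>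

lemma axis_in_prob_vecs: "axis i 1 \<in> prob_vecs"
  by (simp add: prob_vecs_def axis_def)

lemma inner_prob_vec_le:
  fixes x z :: "real ^ 'a::finite"
  assumes "x \<in> prob_vecs" and "\<And>i. z $ i \<le> v"
  shows "x \<bullet> z \<le> v"
proof -
  have "x \<bullet> z \<le> (\<Sum>i\<in>UNIV. x $ i * v)"
    unfolding inner_vec_def inner_real_def
    using assms by (intro sum_mono mult_left_mono) (auto simp: prob_vecs_def)
  also have "\<dots> = v"
    using assms(1) by (simp add: prob_vecs_def flip: sum_distrib_right)
  finally show ?thesis .
qed

text \<open>A linear functional on the simplex attains its maximum at a vertex, so only pure
  strategies need testing. The boundedness established first is what gives the conditionally
  complete \<open>SUP\<close> its meaning.\<close>

lemma SUP_inner_prob_vecs_le_iff: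
  fixes z :: "real ^ 'a::finite"
  shows "(SUP x\<in>prob_vecs. x \<bullet> z) \<le> v \<longleftrightarrow> (\<forall>i. z $ i \<le> v)"
proof -
  have "z $ i \<le> (MAX i. z $ i)" for i
    by (intro Max_ge) auto
  then have "bdd_above ((\<lambda>x. x \<bullet> z) ` prob_vecs)"
    by (intro bdd_aboveI2[where M = "MAX i. z $ i"] inner_prob_vec_le) auto
  then have "(SUP x\<in>prob_vecs. x \<bullet> z) \<le> v \<longleftrightarrow> (\<forall>x\<in>prob_vecs. x \<bullet> z \<le> v)"
    by (intro cSUP_le_iff prob_vecs_nonempty)
  also have "\<dots> \<longleftrightarrow> (\<forall>i. z $ i \<le> v)"
    using inner_prob_vec_le[of _ z v] axis_in_prob_vecs by (metis inner_axis' inner_real_def mult_1)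
  finally show ?thesis .
qed

lemma inner_le_SUP_prob_vecs:
  fixes x z :: "real ^ 'a::finite"
  assumes "x \<in> prob_vecs"
  shows "x \<bullet> z \<le> (SUP x\<in>prob_vecs. x \<bullet> z)"
  using assms SUP_inner_prob_vecs_le_iff[of z "SUP x\<in>prob_vecs. x \<bullet> z"]
  by (intro inner_prob_vec_le) auto

lemma inner_matrix_vector: "x \<bullet> (A *v y) = y \<bullet> (x v* A)" for A :: "real ^ 'a ^ 'b::finite"
  by (metis dot_lmul_matrix inner_commute)

lemma minus_matrix_vector: "(- A) *v y = - (A *v y)" for A :: "real ^ 'a ^ 'b::finite"
  by (simp add: matrix_vector_mult_def vec_eq_iff sum_negf)

text \<open>Player 2's best reply in two guises: as a linear maximisation over the simplex, to which
  the vertex criterion applies, and as the negated payoff that \<open>x\<close> guarantees player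
  1.\<close>

lemma SUP_inner_minus_matrix:
  fixes A :: "real ^ 'a ^ 'a::finite"
  shows "(SUP y\<in>prob_vecs. x \<bullet> ((- A) *v y)) = (SUP y\<in>prob_vecs. y \<bullet> (- (x v* A)))"
    and "(SUP y\<in>prob_vecs. x \<bullet> ((- A) *v y)) = - (INF y\<in>prob_vecs. x \<bullet> (A *v y))"
proof -
  have "x \<bullet> ((- A) *v y) = y \<bullet> (- (x v* A))" for y :: "real ^ 'a"
    by (simp only: minus_matrix_vector inner_minus_right inner_matrix_vector)
  then show "(SUP y\<in>prob_vecs. x \<bullet> ((- A) *v y)) = (SUP y\<in>prob_vecs. y \<bullet> (- (x v* A)))"
    by simp
  show "(SUP y\<in>prob_vecs. x \<bullet> ((- A) *v y)) = - (INF y\<in>prob_vecs. x \<bullet> (A *v y))"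
    by (simp add: minus_matrix_vector Inf_real_def image_image)
qed

lemma INF_prob_vecs_le:
  fixes A :: "real ^ 'a ^ 'a::finite"
  assumes "y \<in> prob_vecs"
  shows "(INF y\<in>prob_vecs. x \<bullet> (A *v y)) \<le> x \<bullet> (A *v y)"
proof -
  have "y \<bullet> (- (x v* A)) \<le> - (INF y\<in>prob_vecs. x \<bullet> (A *v y))"
    unfolding SUP_inner_minus_matrix(2)[symmetric] SUP_inner_minus_matrix(1)
    by (rule inner_le_SUP_prob_vecs[OF assms])
  then show ?thesis
    by (simp add: inner_matrix_vector[of x])
qed

text \<open>Boundedness of the guarantees over all \<open>x\<close> comes from one fixed reply
  \<open>y0\<close>: no guarantee exceeds the best payoff against \<open>y0\<close>.\<close>

lemma INF_le_matrix_value: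
  fixes A :: "real ^ 'a ^ 'a::finite"
  assumes x: "x \<in> prob_vecs"
  shows "(INF y\<in>prob_vecs. x \<bullet> (A *v y)) \<le> matrix_value A"
  unfolding matrix_value_def
proof (rule cSUP_upper[OF x])
  obtain y0 :: "real ^ 'a" where y0: "y0 \<in> prob_vecs"
    using prob_vecs_nonempty by blast
  show "bdd_above ((\<lambda>x. INF y\<in>prob_vecs. x \<bullet> (A *v y)) ` prob_vecs)"
    by (intro bdd_aboveI2[where M = "SUP x\<in>prob_vecs. x \<bullet> (A *v y0)"])
      (rule order.trans[OF INF_prob_vecs_le[OF y0] inner_le_SUP_prob_vecs])
qed

text \<open>Weak duality: what any row strategy guarantees is at most its payoff against
  \<open>y\<close>, hence at most the best payoff against \<open>y\<close>.\<close>

lemma matrix_value_le_SUP: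
  fixes A :: "real ^ 'a ^ 'a::finite"
  assumes y: "y \<in> prob_vecs"
  shows "matrix_value A \<le> (SUP x\<in>prob_vecs. x \<bullet> (A *v y))"
  unfolding matrix_value_def
  by (intro cSUP_least prob_vecs_nonempty order.trans[OF INF_prob_vecs_le[OF y] inner_le_SUP_prob_vecs])

text \<open>Both the expected payoff and \<open>matrix_value A\<close> lie between the
  \<open>INF\<close> for \<open>x\<close> and the \<open>SUP\<close> for \<open>y\<close>. The
  saddle inequalities say \<open>SUP\<close> \<le> payoff \<le> \<open>INF\<close>, which collapses
  all four numbers into one; conversely, the left-hand side equates them.\<close>

lemma minimax_bistrategy_iff_saddle:
  fixes A :: "real ^ 'a ^ 'a::finite"
  assumes x: "x \<in> prob_vecs" and y: "y \<in> prob_vecs"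
  shows "minimax_bistrategy A x y \<and> x \<bullet> (A *v y) = matrix_value A \<longleftrightarrow>
    (\<forall>i. (A *v y) $ i \<le> x \<bullet> (A *v y)) \<and> (\<forall>j. x \<bullet> (A *v y) \<le> (x v* A) $ j)"
    (is "?L \<longleftrightarrow> ?R")
proof -
  let ?v = "x \<bullet> (A *v y)"
  have sup: "(SUP x'\<in>prob_vecs. x' \<bullet> (A *v y)) \<le> ?v \<longleftrightarrow> (\<forall>i. (A *v y) $ i \<le> ?v)"
    by (rule SUP_inner_prob_vecs_le_iff)
  have inf: "?v \<le> (INF y'\<in>prob_vecs. x \<bullet> (A *v y')) \<longleftrightarrow> (\<forall>j. ?v \<le> (x v* A) $ j)"
    using SUP_inner_prob_vecs_le_iff[of "- (x v* A)" "- ?v"]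
    unfolding SUP_inner_minus_matrix(1)[symmetric] SUP_inner_minus_matrix(2) by simp
  have "?v \<le> (SUP x'\<in>prob_vecs. x' \<bullet> (A *v y))"
    by (rule inner_le_SUP_prob_vecs[OF x])
  then show ?thesis
    using INF_prob_vecs_le[OF y, of x A] INF_le_matrix_value[OF x, of A]
      matrix_value_le_SUP[OF y, of A] x y
    unfolding minimax_bistrategy_def sup[symmetric] inf[symmetric] SUP_inner_minus_matrix(2)
    by auto
qed

subsection \<open>The Bellman equation\<close>

lemma G_mat_vector: "(G_mat p \<pi> *v f) $ s = measure_pmf.expectation (step_law p \<pi> s) (($) f)"
  by (simp add: matrix_vector_mult_def integral_measure_pmf_real[where A = UNIV] pmf_step_law mult_ac)

text \<open>\<open>state_law\<close> appends steps at the end, whereas the Bellman recursion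
  conditions on the first step; associativity of bind passes from one to the other.\<close>

lemma state_law_Suc_left:
  "state_law p \<pi> s (Suc t) = bind_pmf (step_law p \<pi> s) (\<lambda>s'. state_law p \<pi> s' t)"
proof (induction t)
  case 0
  show ?case
    by (simp add: bind_return_pmf bind_return_pmf')
next
  case (Suc t)
  then show ?case
    by (simp add: bind_assoc_pmf)
qed

lemma expectation_bind_pmf_finite:
  fixes f :: "'b::finite \<Rightarrow> real" and q :: "'a::finite pmf"
  shows "measure_pmf.expectation (bind_pmf q K) f =
    (\<Sum>x\<in>UNIV. pmf q x * measure_pmf.expectation (K x) f)"
proof -
  have "measure_pmf.expectation (bind_pmf q K) f = (\<Sum>y\<in>UNIV. \<Sum>x\<in>UNIV. pmf q x * (f y * pmf (K x) y))"
    by (simp add: integral_measure_pmf_real[where A = UNIV] pmf_bind sum_distrib_left mult_ac)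
  also have "\<dots> = (\<Sum>x\<in>UNIV. \<Sum>y\<in>UNIV. pmf q x * (f y * pmf (K x) y))"
    by (rule sum.swap)
  finally show ?thesis
    by (simp add: integral_measure_pmf_real[where A = UNIV] sum_distrib_left)
qed

lemma abs_expectation_pmf_le:
  fixes f :: "'b::finite \<Rightarrow> real"
  assumes "\<And>x. \<bar>f x\<bar> \<le> C"
  shows "\<bar>measure_pmf.expectation q f\<bar> \<le> C"
proof -
  have "\<bar>measure_pmf.expectation q f\<bar> \<le> (\<Sum>x\<in>UNIV. C * pmf q x)"
    unfolding integral_measure_pmf_real[where A = UNIV, OF finite UNIV_I]
    by (rule order.trans[OF sum_abs]) (auto simp: abs_mult intro!: sum_mono mult_right_mono assms)
  also have "\<dots> = C"
    by (simp add: sum_pmf_eq_1 flip: sum_distrib_left)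
  finally show ?thesis .
qed

lemma abs_G_mat_vector_le:
  assumes "\<And>s. \<bar>f $ s\<bar> \<le> C"
  shows "\<bar>(G_mat p \<pi> *v f) $ s\<bar> \<le> C"
  unfolding G_mat_vector by (rule abs_expectation_pmf_le) (rule assms)

text \<open>Split off the term at time 0, condition the remaining terms on the first transition, and
  pull one factor \<gamma> out of the shifted series.\<close>

lemma Bellman_equation:
  fixes p :: "('s::finite, 'a::finite) transition"
  assumes "0 \<le> \<gamma>" and "\<gamma> < 1"
  shows "V_fun p \<gamma> r \<pi> s =
    mean_reward r \<pi> s + \<gamma> * (G_mat p \<pi> *v (\<chi> s. V_fun p \<gamma> r \<pi> s)) $ s"
proof -
  define E where "E s t = measure_pmf.expectation (state_law p \<pi> s t) (mean_reward r \<pi>)" for s t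
  define C where "C = (MAX s. \<bar>mean_reward r \<pi> s\<bar>)"
  have E_bound: "\<bar>E s t\<bar> \<le> C" for s t
    unfolding E_def C_def by (intro abs_expectation_pmf_le Max_ge) auto
  \<comment> \<open>Domination by a geometric series; this summability later permits exchanging the
    series with the finite sum over successor states.\<close>
  have summ: "summable (\<lambda>t. \<gamma> ^ t * E s t)" for s
  proof (rule summable_comparison_test')
    show "summable (\<lambda>t. C * \<gamma> ^ t)"
      using assms by (intro summable_mult summable_geometric) auto
    show "norm (\<gamma> ^ t * E s t) \<le> C * \<gamma> ^ t" for t
      using E_bound[of s t] assms
      by (simp add: abs_mult mult.commute[of C] mult_left_mono)
  qed
  have E_Suc: "E s (Suc t) = (\<Sum>s'\<in>UNIV. G_mat p \<pi> $ s $ s' * E s' t)" for t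
    unfolding E_def state_law_Suc_left expectation_bind_pmf_finite by (simp add: pmf_step_law)
  have V: "V_fun p \<gamma> r \<pi> s = (\<Sum>t. \<gamma> ^ t * E s t)" for s
    by (simp add: V_fun_def E_def)
  have "V_fun p \<gamma> r \<pi> s = E s 0 + (\<Sum>t. \<gamma> ^ Suc t * E s (Suc t))"
    unfolding V using suminf_split_head[OF summ[of s]] by simp
  also have "(\<Sum>t. \<gamma> ^ Suc t * E s (Suc t)) =
      (\<Sum>t. \<Sum>s'\<in>UNIV. \<gamma> * G_mat p \<pi> $ s $ s' * (\<gamma> ^ t * E s' t))"
    by (simp add: E_Suc sum_distrib_left mult_ac)
  also have "\<dots> = (\<Sum>s'\<in>UNIV. \<Sum>t. \<gamma> * G_mat p \<pi> $ s $ s' * (\<gamma> ^ t * E s' t))"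
    by (intro suminf_sum summable_mult summ)
  also have "\<dots> = (\<Sum>s'\<in>UNIV. \<gamma> * G_mat p \<pi> $ s $ s' * V_fun p \<gamma> r \<pi> s')"
    unfolding V by (intro sum.cong suminf_mult summ refl)
  also have "\<dots> = \<gamma> * (G_mat p \<pi> *v (\<chi> s. V_fun p \<gamma> r \<pi> s)) $ s"
    by (simp add: matrix_vector_mult_def sum_distrib_left mult_ac)
  also have "E s 0 = mean_reward r \<pi> s"
    by (simp add: E_def)
  finally show ?thesis .
qed

text \<open>The rows of \<open>G_mat\<close> are probability distributions, so \<gamma> G contracts
  the maximum norm and I - \<gamma> G has trivial kernel.\<close>

lemma invertible_resolvent:
  fixes p :: "('s::finite, 'a::finite) transition"
  assumes "0 \<le> \<gamma>" and "\<gamma> < 1"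
  shows "invertible (mat 1 - \<gamma> *\<^sub>R G_mat p \<pi>)"
proof -
  have "x = 0" if "(mat 1 - \<gamma> *\<^sub>R G_mat p \<pi>) *v x = 0" for x
  proof -
    have x: "x = \<gamma> *\<^sub>R (G_mat p \<pi> *v x)"
      using that by (simp add: matrix_vector_mult_diff_rdistrib scaleR_matrix_vector_assoc)
    define C where "C = (MAX s. \<bar>x $ s\<bar>)"
    have C: "\<bar>x $ s\<bar> \<le> C" for s
      unfolding C_def by (intro Max_ge) auto
    have "C \<in> range (\<lambda>s. \<bar>x $ s\<bar>)"
      unfolding C_def by (intro Max_in) auto
    \<comment> \<open>At a state where the maximum \<open>C\<close> is attained, the fixed point
      equation gives \<open>C\<close> \<le> \<gamma> \<open>C\<close>.\<close>
    then obtain s where s: "C = \<bar>x $ s\<bar>"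
      by blast
    also have "\<dots> = \<gamma> * \<bar>(G_mat p \<pi> *v x) $ s\<bar>"
      by (subst x) (use assms in \<open>simp add: abs_mult\<close>)
    also have "\<dots> \<le> \<gamma> * C"
      using assms by (intro mult_left_mono abs_G_mat_vector_le C)
    finally have "(1 - \<gamma>) * C \<le> 0"
      by (simp add: algebra_simps)
    then have "C \<le> 0"
      using assms by (simp add: mult_le_0_iff)
    then have "x $ s = 0" for s
      using C[of s] by simp
    then show "x = 0"
      by (simp add: vec_eq_iff)
  qed
  then show ?thesis
    by (metis invertible_left_inverse matrix_left_invertible_ker)
qed

section \<open>The matrices B and D acting on reward vectors\<close>

lemma sum_triple: "(\<Sum>c\<in>UNIV. h c) = (\<Sum>s\<in>UNIV. \<Sum>i\<in>UNIV. \<Sum>j\<in>UNIV. h (s, i, j))"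
  for h :: "'s::finite \<times> 'a::finite \<times> 'b::finite \<Rightarrow> 'c::comm_monoid_add"
  by (simp add: sum.cartesian_product flip: UNIV_Times_UNIV)

lemma B_mat_vector: "(B_mat \<pi> *v q) $ s = mean_reward q \<pi> s"
proof -
  have "(B_mat \<pi> *v q) $ s = (\<Sum>s'\<in>UNIV. if s' = s then mean_reward q \<pi> s else 0)"
    unfolding matrix_vector_mult_def vec_lambda_beta sum_triple
    by (intro sum.cong) (auto simp: B_mat_def mean_reward_def)
  then show ?thesis
    by simp
qed

lemma matrix_inv_inverts:
  fixes A :: "'a::semiring_1 ^ 'n ^ 'm"
  assumes "invertible A"
  shows matrix_inv_right: "A ** matrix_inv A = mat 1"
    and matrix_inv_left: "matrix_inv A ** A = mat 1"
  using someI_ex[of "\<lambda>A'. A ** A' = mat 1 \<and> A' ** A = mat 1"] assms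
  unfolding invertible_def matrix_inv_def by auto

lemma matrix_inv_solve:
  fixes A :: "real ^ 'n::finite ^ 'n"
  assumes "invertible A" and "A *v x = b"
  shows "matrix_inv A *v b = x"
  using assms by (metis matrix_inv_left matrix_vector_mul_assoc matrix_vector_mul_lid)

lemma D_mat_vector:
  fixes p :: "('s::finite, 'a::finite) transition"
  assumes "0 \<le> \<gamma>" and "\<gamma> < 1"
  shows "D_mat p \<gamma> \<pi> *v r = (\<chi> k. case k of (s, i, j) \<Rightarrow> Q_fun p \<gamma> r \<pi> s i j)"
proof -
  let ?V = "\<chi> s. V_fun p \<gamma> r \<pi> s"
  \<comment> \<open>The Bellman equation in matrix form; solving it for V produces the resolvent in
    \<open>D_mat\<close>.\<close>
  have "(mat 1 - \<gamma> *\<^sub>R G_mat p \<pi>) *v ?V = B_mat \<pi> *v r"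
    unfolding vec_eq_iff
  proof
    fix s
    show "((mat 1 - \<gamma> *\<^sub>R G_mat p \<pi>) *v ?V) $ s = (B_mat \<pi> *v r) $ s"
      using Bellman_equation[OF assms, of p r \<pi> s]
      unfolding matrix_vector_mult_diff_rdistrib scaleR_matrix_vector_assoc[symmetric] B_mat_vector
        matrix_vector_mul_lid vector_minus_component vector_scaleR_component real_scaleR_def vec_lambda_beta
      by linarith
  qed
  then have "matrix_inv (mat 1 - \<gamma> *\<^sub>R G_mat p \<pi>) *v (B_mat \<pi> *v r) = ?V"
    by (intro matrix_inv_solve invertible_resolvent assms)
  then have "D_mat p \<gamma> \<pi> *v r = r + \<gamma> *\<^sub>R (P_mat p *v ?V)"
    unfolding D_mat_def matrix_vector_mult_add_rdistrib scaleR_matrix_vector_assoc[symmetric]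
      matrix_vector_mul_assoc[symmetric] matrix_vector_mul_lid by (simp only:)
  then show ?thesis
    by (auto simp: vec_eq_iff Q_fun_def P_mat_def matrix_vector_mult_def)
qed

subsection \<open>Minimax bi-policies\<close>

lemma policy_vec_in_prob_vecs: "policy_vec q s \<in> prob_vecs"
  by (simp add: prob_vecs_def policy_vec_def sum_pmf_eq_1)

text \<open>\<open>A\<close> has to match \<open>q\<close> at the single state \<open>s\<close>
  only, so a reward vector can be read there as a matrix game.\<close>

lemma mean_reward_eq_inner:
  assumes "\<And>i j. q $ (s, i, j) = A $ i $ j"
  shows "mean_reward q \<pi> s = policy_vec (fst \<pi>) s \<bullet> (A *v policy_vec (snd \<pi>) s)"
  by (simp add: mean_reward_def policy_vec_def inner_vec_def matrix_vector_mult_def assms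
      sum_distrib_left mult_ac)

lemma policy_vec_return_pmf: "policy_vec (\<lambda>s. return_pmf i) s = axis i 1"
  by (auto simp: policy_vec_def axis_def vec_eq_iff indicator_def)

text \<open>Averaging Q over both actions reproduces the right-hand side of the Bellman equation.
  The value condition in \<open>minimax_bipolicy\<close> thus becomes the payoff condition of the
  saddle point lemma.\<close>

lemma mean_Q_eq_V:
  fixes p :: "('s::finite, 'a::finite) transition"
  assumes "0 \<le> \<gamma>" and "\<gamma> < 1"
  shows "policy_vec (fst \<pi>) s \<bullet> (Q_mat p \<gamma> r \<pi> s *v policy_vec (snd \<pi>) s) = V_fun p \<gamma> r \<pi> s"
proof -
  let ?V = "\<chi> s. V_fun p \<gamma> r \<pi> s"
  let ?w = "\<lambda>a1 a2. pmf (fst \<pi> s) a1 * pmf (snd \<pi> s) a2"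
  have "(G_mat p \<pi> *v ?V) $ s = (\<Sum>s'\<in>UNIV. \<Sum>a1\<in>UNIV. \<Sum>a2\<in>UNIV. ?w a1 a2 * (pmf (p s a1 a2) s' * ?V $ s'))"
    by (simp add: matrix_vector_mult_def G_mat_def sum_distrib_right mult.assoc)
  \<comment> \<open>Two exchanges move the sum over successor states inside the sums over both
    actions.\<close>
  also have "\<dots> = (\<Sum>a1\<in>UNIV. \<Sum>s'\<in>UNIV. \<Sum>a2\<in>UNIV. ?w a1 a2 * (pmf (p s a1 a2) s' * ?V $ s'))"
    by (rule sum.swap)
  also have "\<dots> = (\<Sum>a1\<in>UNIV. \<Sum>a2\<in>UNIV. \<Sum>s'\<in>UNIV. ?w a1 a2 * (pmf (p s a1 a2) s' * ?V $ s'))"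
    by (intro sum.cong sum.swap refl)
  finally have G: "(G_mat p \<pi> *v ?V) $ s =
      (\<Sum>a1\<in>UNIV. \<Sum>a2\<in>UNIV. ?w a1 a2 * (\<Sum>s'\<in>UNIV. pmf (p s a1 a2) s' * ?V $ s'))"
    by (simp add: sum_distrib_left)
  have "policy_vec (fst \<pi>) s \<bullet> (Q_mat p \<gamma> r \<pi> s *v policy_vec (snd \<pi>) s) =
      (\<Sum>a1\<in>UNIV. \<Sum>a2\<in>UNIV. ?w a1 a2 * Q_fun p \<gamma> r \<pi> s a1 a2)"
    by (simp add: policy_vec_def inner_vec_def matrix_vector_mult_def Q_mat_def sum_distrib_left mult_ac)
  also have "\<dots> = mean_reward r \<pi> s + \<gamma> * (G_mat p \<pi> *v ?V) $ s"
    unfolding G mean_reward_def Q_fun_def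
    by (simp add: distrib_left sum.distrib sum_distrib_left mult_ac)
  also have "\<dots> = V_fun p \<gamma> r \<pi> s"
    by (rule Bellman_equation[OF assms, symmetric])
  finally show ?thesis .
qed

text \<open>Row \<open>s\<close> of each constraint is the change in player 1's expected payoff in
  the game Q(s) when one player switches to a pure action.\<close>

lemma B_diff_D_mat_vector:
  fixes p :: "('s::finite, 'a::finite) transition" and \<pi> :: "('s, 'a) bipolicy"
  assumes "0 \<le> \<gamma>" and "\<gamma> < 1"
  defines "x \<equiv> policy_vec (fst \<pi>)" and "y \<equiv> policy_vec (snd \<pi>)"
  shows "(((B_fix1 \<pi> i - B_mat \<pi>) ** D_mat p \<gamma> \<pi>) *v r) $ s =
      (Q_mat p \<gamma> r \<pi> s *v y s) $ i - x s \<bullet> (Q_mat p \<gamma> r \<pi> s *v y s)" (is ?fix1)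
    and "(((B_fix2 \<pi> j - B_mat \<pi>) ** D_mat p \<gamma> \<pi>) *v r) $ s =
      (x s v* Q_mat p \<gamma> r \<pi> s) $ j - x s \<bullet> (Q_mat p \<gamma> r \<pi> s *v y s)" (is ?fix2)
proof -
  \<comment> \<open>Only the averaging policy \<pi>' varies; \<open>D_mat\<close> keeps \<pi>. This
    is a one-shot deviation after which \<pi> is followed.\<close>
  have B: "(B_mat \<pi>' *v (D_mat p \<gamma> \<pi> *v r)) $ s =
      policy_vec (fst \<pi>') s \<bullet> (Q_mat p \<gamma> r \<pi> s *v policy_vec (snd \<pi>') s)" for \<pi>'
    unfolding B_mat_vector by (rule mean_reward_eq_inner) (simp add: D_mat_vector assms Q_mat_def)
  show ?fix1
    by (simp add: matrix_vector_mul_assoc[symmetric] matrix_vector_mult_diff_rdistrib B_fix1_def B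
        policy_vec_return_pmf inner_axis' x_def y_def)
  show ?fix2
    by (simp add: matrix_vector_mul_assoc[symmetric] matrix_vector_mult_diff_rdistrib B_fix2_def B
        policy_vec_return_pmf inner_matrix_vector[of _ _ "axis j 1"] inner_axis' x_def y_def)
qed

lemma minimax_bipolicy_iff:
  fixes p :: "('s::finite, 'a::finite) transition"
  assumes "0 \<le> \<gamma>" and "\<gamma> < 1"
  shows "minimax_bipolicy p \<gamma> r \<pi> \<longleftrightarrow>
    (\<forall>j. ((B_fix2 \<pi> j - B_mat \<pi>) ** D_mat p \<gamma> \<pi>) *v r \<ge> 0) \<and>
    (\<forall>i. ((B_fix1 \<pi> i - B_mat \<pi>) ** D_mat p \<gamma> \<pi>) *v r \<le> 0)"
proof -
  let ?A = "Q_mat p \<gamma> r \<pi>" and ?x = "policy_vec (fst \<pi>)" and ?y = "policy_vec (snd \<pi>)"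
  have "minimax_bipolicy p \<gamma> r \<pi> \<longleftrightarrow> (\<forall>s.
      minimax_bistrategy (?A s) (?x s) (?y s) \<and> ?x s \<bullet> (?A s *v ?y s) = matrix_value (?A s))"
    by (simp add: minimax_bipolicy_def mean_Q_eq_V assms)
  also have "\<dots> \<longleftrightarrow> (\<forall>s. (\<forall>i. (?A s *v ?y s) $ i \<le> ?x s \<bullet> (?A s *v ?y s)) \<and>
      (\<forall>j. ?x s \<bullet> (?A s *v ?y s) \<le> (?x s v* ?A s) $ j))"
    by (simp only: minimax_bistrategy_iff_saddle policy_vec_in_prob_vecs)
  finally show ?thesis
    by (auto simp: less_eq_vec_def B_diff_D_mat_vector assms)
qed

subsection \<open>Gaussian densities and quadratic forms\<close>

lemma invertible_if_pos_def:
  fixes A :: "real ^ 'n::finite ^ 'n"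
  assumes "\<And>x. x \<noteq> 0 \<Longrightarrow> 0 < x \<bullet> (A *v x)"
  shows "invertible A"
proof -
  have "x = 0" if "A *v x = 0" for x
    using assms[of x] that by auto
  then show ?thesis
    by (metis invertible_left_inverse matrix_left_invertible_ker)
qed

lemma det_pos_if_pos_def:
  fixes A :: "real ^ 'n::finite ^ 'n"
  assumes pos: "\<And>x. x \<noteq> 0 \<Longrightarrow> 0 < x \<bullet> (A *v x)"
  shows "0 < det A"
proof (rule ccontr)
  \<comment> \<open>The segment from the identity to \<open>A\<close> consists of positive definite matrices, so \<open>det\<close> cannot
    change sign along it.\<close>
  define H where "H t = (1 - t) *\<^sub>R mat 1 + t *\<^sub>R A" for t :: real
  assume "\<not> 0 < det A"
  then have "det (H 1) \<le> 0" "0 \<le> det (H 0)"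
    by (simp_all add: H_def det_I)
  moreover have "continuous_on {0..1} (\<lambda>t. det (H t))"
    unfolding H_def det_def by (auto intro!: continuous_intros)
  ultimately obtain t where t: "0 \<le> t" "t \<le> 1" "det (H t) = 0"
    using IVT2'[of "\<lambda>t. det (H t)" 1 0 0] by auto
  have "0 < x \<bullet> (H t *v x)" if "x \<noteq> 0" for x
  proof -
    have "x \<bullet> (H t *v x) = (1 - t) * (x \<bullet> x) + t * (x \<bullet> (A *v x))"
      by (simp add: H_def matrix_vector_mult_add_rdistrib scaleR_matrix_vector_assoc[symmetric]
          inner_add_right)
    moreover have "0 < x \<bullet> x" "0 < x \<bullet> (A *v x)"
      using that pos by auto
    \<comment> \<open>At \<open>t = 0\<close> positivity comes from the identity; for
      \<open>t > 0\<close> it comes from the term with \<open>A\<close>.\<close>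
    ultimately show ?thesis
      using t by (cases "t = 0") (auto intro: add_nonneg_pos)
  qed
  then have "invertible (H t)"
    by (rule invertible_if_pos_def)
  then show False
    using t(3) by (simp add: invertible_det_nz)
qed

text \<open>Substituting x = A y turns the form of the inverse into the form of A at y.\<close>

lemma matrix_inv_nonneg_if_pos_def:
  fixes A :: "real ^ 'n::finite ^ 'n"
  assumes "\<And>x. x \<noteq> 0 \<Longrightarrow> 0 < x \<bullet> (A *v x)"
  shows "0 \<le> x \<bullet> (matrix_inv A *v x)"
proof -
  define y where "y = matrix_inv A *v x"
  have "A *v y = x"
    using invertible_if_pos_def[OF assms] unfolding y_def
    by (simp add: matrix_vector_mul_assoc matrix_inv_right)
  then have "x \<bullet> (matrix_inv A *v x) = y \<bullet> (A *v y)"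
    by (simp add: y_def inner_commute)
  then show ?thesis
    using assms[of y] by (cases "y = 0") auto
qed

lemma convex_on_quadratic_form:
  fixes A :: "real ^ 'n::finite ^ 'n"
  assumes "\<And>x. 0 \<le> x \<bullet> (A *v x)"
  shows "convex_on UNIV (\<lambda>x. (x - \<mu>) \<bullet> (A *v (x - \<mu>)))"
proof (rule convex_onI)
  fix t :: real and x y :: "real ^ 'n"
  assume t: "0 < t" "t < 1"
  let ?q = "\<lambda>x. x \<bullet> (A *v x)"
  define u w where "u = x - \<mu>" and "w = y - \<mu>"
  have "(1 - t) *\<^sub>R x + t *\<^sub>R y - \<mu> = (1 - t) *\<^sub>R u + t *\<^sub>R w"
    by (simp add: u_def w_def algebra_simps)
  \<comment> \<open>The exact convexity defect of a quadratic form: the mixed terms of u and w on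
    the left are those produced by expanding q(u - w).\<close>
  moreover have "?q ((1 - t) *\<^sub>R u + t *\<^sub>R w) = (1 - t) * ?q u + t * ?q w - t * (1 - t) * ?q (u - w)"
    by (simp add: matrix_vector_right_distrib matrix_vector_mult_diff_distrib
        matrix_vector_mult_scaleR inner_simps) (simp add: algebra_simps)
  moreover have "0 \<le> t * (1 - t) * ?q (u - w)"
    using t assms by simp
  ultimately show "?q ((1 - t) *\<^sub>R x + t *\<^sub>R y - \<mu>) \<le> (1 - t) * ?q (x - \<mu>) + t * ?q (y - \<mu>)"
    by (simp add: u_def w_def)
qed simp

lemma convex_on_qp_objective:
  assumes "sym_pos_def \<Sigma>"
  shows "convex_on UNIV (qp_objective \<mu> \<Sigma>)"
  unfolding qp_objective_def using assms
  by (intro convex_on_cmul convex_on_quadratic_form matrix_inv_nonneg_if_pos_def)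
    (auto simp: sym_pos_def_def)

text \<open>The normalising factor is positive and independent of the point, and exp is strictly
  increasing, so strict comparisons are reversed.\<close>

lemma gaussian_density_less_iff:
  assumes "sym_pos_def \<Sigma>"
  shows "gaussian_density \<mu> \<Sigma> x < gaussian_density \<mu> \<Sigma> y \<longleftrightarrow> qp_objective \<mu> \<Sigma> y < qp_objective \<mu> \<Sigma> x"
proof -
  have "0 < det \<Sigma>"
    using assms by (intro det_pos_if_pos_def) (auto simp: sym_pos_def_def)
  then have "0 < sqrt ((2 * pi) ^ CARD('a) * det \<Sigma>)"
    by simp
  then show ?thesis
    by (auto simp: gaussian_density_def qp_objective_def divide_less_cancel)
qed

text \<open>The feasible set is an intersection of preimages of orthants under linear maps.\<close>

lemma convex_qp_feasible: "convex {r. qp_feasible p \<gamma> \<pi> r}"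
proof -
  have *: "convex {r. A *v r \<le> 0}" "convex {r. A *v r \<ge> 0}" for A :: "real ^ 'n::finite ^ 'm::finite"
    by (auto simp: convex_def less_eq_vec_def matrix_vector_right_distrib matrix_vector_mult_scaleR
        mult_nonneg_nonpos add_nonpos_nonpos)
  have "{r. qp_feasible p \<gamma> \<pi> r} =
      (\<Inter>i. {r. ((B_fix1 \<pi> i - B_mat \<pi>) ** D_mat p \<gamma> \<pi>) *v r \<le> 0}) \<inter>
      (\<Inter>j. {r. ((B_fix2 \<pi> j - B_mat \<pi>) ** D_mat p \<gamma> \<pi>) *v r \<ge> 0})"
    by (auto simp: qp_feasible_def)
  then show ?thesis
    by (simp only:) (intro convex_Int convex_INT *)
qed

theorem mainTheorem1:
  fixes p :: "('s::finite, 'a::finite) transition"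
    and \<gamma> :: real
    and \<pi> :: "('s, 'a) bipolicy"
  assumes "0 \<le> \<gamma>" and "\<gamma> < 1"
  shows "(\<forall>r :: ('s, 'a) reward.
            minimax_bipolicy p \<gamma> r \<pi> \<longleftrightarrow>
              (\<forall>j. ((B_fix2 \<pi> j - B_mat \<pi>) ** D_mat p \<gamma> \<pi>) *v r \<ge> 0) \<and>
              (\<forall>i. ((B_fix1 \<pi> i - B_mat \<pi>) ** D_mat p \<gamma> \<pi>) *v r \<le> 0)) \<and>
         (\<forall>(\<mu> :: ('s, 'a) reward) \<Sigma>. sym_pos_def \<Sigma> \<longrightarrow>
            {r. likelihood p \<gamma> \<pi> r = 1} = {r. qp_feasible p \<gamma> \<pi> r} \<and>
            {r. is_arg_max (gaussian_density \<mu> \<Sigma>) (\<lambda>r. likelihood p \<gamma> \<pi> r = 1) r} =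
              {r. is_arg_min (qp_objective \<mu> \<Sigma>) (qp_feasible p \<gamma> \<pi>) r} \<and>
            convex_on UNIV (qp_objective \<mu> \<Sigma>) \<and>
            convex {r. qp_feasible p \<gamma> \<pi> r})"
proof -
  have minimax: "minimax_bipolicy p \<gamma> r \<pi> \<longleftrightarrow> qp_feasible p \<gamma> \<pi> r" for r
    unfolding minimax_bipolicy_iff[OF assms] qp_feasible_def by blast
  then have likelihood: "likelihood p \<gamma> \<pi> r = 1 \<longleftrightarrow> qp_feasible p \<gamma> \<pi> r" for r
    by (simp add: likelihood_def)
  \<comment> \<open>\<open>is_arg_max\<close> and \<open>is_arg_min\<close> forbid a strictly better
    feasible point, so equal feasible sets and the reversed strict order give equal sets of
    optima.\<close>
  show ?thesis
    by (simp add: minimax_bipolicy_iff[OF assms] likelihood is_arg_max_def is_arg_min_def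
        gaussian_density_less_iff convex_on_qp_objective convex_qp_feasible)
qed

end
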